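(* Let $p(z)=a_0z^n+a_1z^{n-1}+\cdots+a_n$ be a polynomial with real coefficients, $a_0>0$, $n\ge1$, and let $1\le m\le n$. Then $p$ has exactly $m$ distinct zeros, all of which are real, if and only if $$D_j(L)>0,\quad j=1,2,\ldots,m,\qquad\text{and}\qquad D_j(L)=0,\quad j>m,$$ where $L=p'/p$ is the logarithmic derivative of $p$.
   Context: Expand $L(z)=\dfrac{p'(z)}{p(z)}=\dfrac{s_0}{z}+\dfrac{s_1}{z^2}+\dfrac{s_2}{z^3}+\cdots$ at $\infty$. Then $D_j(L)=\det\|s_{i+l}\|_{i,l=0}^{j-1}$, $j=1,2,\ldots$ (Hankel determinants). *)

theory Defs
  imports
    "HOL-Computational_Algebra.Formal_Laurent_Series"
    "HOL-Computational_Algebra.Polynomial"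
    "Jordan_Normal_Form.Determinant"
begin

text \<open>
  Expansions at infinity live in the field of formal Laurent series in \<open>1/z\<close>: the series
  variable \<open>fls_X\<close> stands for \<open>1/z\<close>, hence \<open>fls_X_inv\<close> stands for \<open>z\<close>, and the coefficient
  of \<open>1/z^k\<close> is the one with index \<open>k\<close>.
\<close>

definition poly_at_infinity :: "'a::field poly \<Rightarrow> 'a fls" where
  "poly_at_infinity p = poly (map_poly fls_const p) fls_X_inv"

definition log_deriv_at_infinity :: "'a::field poly \<Rightarrow> 'a fls" where
  "log_deriv_at_infinity p = poly_at_infinity (pderiv p) / poly_at_infinity p"

text \<open>
  If \<open>F = s\<^sub>0/z + s\<^sub>1/z^2 + s\<^sub>2/z^3 + \<dots>\<close>, then \<open>s\<^sub>k\<close> has index \<open>k + 1\<close>.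
\<close>

definition hankel_det :: "nat \<Rightarrow> 'a::field fls \<Rightarrow> 'a" where
  "hankel_det j F = det (mat j j (\<lambda>(i, l). fls_nth F (int (i + l) + 1)))"

end

theory Submission
  imports Defs "HOL-Computational_Algebra.Fundamental_Theorem_Algebra"
begin

text \<open>
  The coefficients of \<open>p'/p\<close> are the power sums \<open>s\<^sub>k = \<Sum>\<^sub>z w\<^sub>z z\<^sup>k\<close> over the distinct zeros \<open>z\<close>,
  weighted by their multiplicities \<open>w\<^sub>z > 0\<close>, so the Hankel form sends polynomials \<open>f, g\<close> of degree
  less than \<open>j\<close> to \<open>\<Sum>\<^sub>z w\<^sub>z f(z) g(z)\<close>. Interpolation at the zeros shows that the Hankel determinant
  of order \<open>r\<close>, the number of distinct zeros, is nonzero, while all higher ones vanish. If the zeros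
  are real, the form is positive definite for \<open>j \<le> r\<close>, and Sylvester's criterion applies.
  Conversely, if it is positive definite for \<open>j = r\<close> and \<open>u\<close> is a nonreal zero, then
  \<open>f = \<Prod>\<^sub>v\<^sub>\<noteq>\<^sub>u (z - v)\<close> satisfies \<open>\<Sum>\<^sub>z w\<^sub>z f(z) cnj (f (cnj z)) = 0\<close>, because \<open>f (cnj u) = 0\<close>,
  which contradicts definiteness.
\<close>

section \<open>Bilinear forms, leading minors and Sylvester's criterion\<close>

definition leading_minor :: "(nat \<Rightarrow> nat \<Rightarrow> 'a::comm_ring_1) \<Rightarrow> nat \<Rightarrow> 'a" where
  "leading_minor a n = det (mat n n (\<lambda>(i, l). a i l))"

text \<open>Matrices and vectors are functions on all of \<open>nat\<close> of which only the
  entries below \<open>n\<close> count, so one \<open>a\<close> serves every order and inductions on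
  \<open>n\<close> need no change of dimension.\<close>

definition bilin :: "(nat \<Rightarrow> nat \<Rightarrow> 'a::comm_ring_1) \<Rightarrow> nat \<Rightarrow> (nat \<Rightarrow> 'a) \<Rightarrow> (nat \<Rightarrow> 'a) \<Rightarrow> 'a" where
  "bilin a n x y = (\<Sum>i<n. x i * (\<Sum>l<n. a i l * y l))"

definition pos_def :: "(nat \<Rightarrow> nat \<Rightarrow> real) \<Rightarrow> nat \<Rightarrow> bool" where
  "pos_def a n \<longleftrightarrow> (\<forall>x. (\<exists>i<n. x i \<noteq> 0) \<longrightarrow> bilin a n x x > 0)"

lemma bilin_add_left: "bilin a n (\<lambda>i. x i + x' i) y = bilin a n x y + bilin a n x' y"
  by (simp add: bilin_def ring_distribs sum.distrib)

lemma bilin_add_right: "bilin a n x (\<lambda>i. y i + y' i) = bilin a n x y + bilin a n x y'"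
  by (simp add: bilin_def ring_distribs sum.distrib)

lemma bilin_scale_left: "bilin a n (\<lambda>i. c * x i) y = c * bilin a n x y"
  by (simp add: bilin_def sum_distrib_left mult_ac)

lemma bilin_scale_right: "bilin a n x (\<lambda>i. c * y i) = c * bilin a n x y"
  by (simp add: bilin_def sum_distrib_left mult_ac)

lemma bilin_commute:
  assumes "\<And>i l. a i l = a l i"
  shows "bilin a n x y = bilin a n y x"
proof -
  have "bilin a n x y = (\<Sum>i<n. \<Sum>l<n. x i * a i l * y l)"
    by (simp add: bilin_def sum_distrib_left mult_ac)
  also have "\<dots> = (\<Sum>l<n. \<Sum>i<n. x i * a i l * y l)"
    by (rule sum.swap)
  also have "\<dots> = bilin a n y x"
    by (simp add: bilin_def sum_distrib_left mult_ac assms)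
  finally show ?thesis .
qed

lemma bilin_Suc_last_zero:
  assumes "x n = 0" "y n = 0"
  shows "bilin a (Suc n) x y = bilin a n x y"
  using assms by (simp add: bilin_def)

lemma leading_minor_eq_0_iff:
  fixes a :: "nat \<Rightarrow> nat \<Rightarrow> 'a::field"
  shows "leading_minor a n = 0 \<longleftrightarrow>
    (\<exists>x. (\<exists>i<n. x i \<noteq> 0) \<and> (\<forall>i<n. (\<Sum>l<n. a i l * x l) = 0))"
proof -
  let ?A = "mat n n (\<lambda>(i, l). a i l)"
  have mult: "?A *\<^sub>v vec n x = 0\<^sub>v n \<longleftrightarrow> (\<forall>i<n. (\<Sum>l<n. a i l * x l) = 0)" for x
    by (auto simp: vec_eq_iff scalar_prod_def atLeast0LessThan)
  have nz: "vec n x \<noteq> 0\<^sub>v n \<longleftrightarrow> (\<exists>i<n. x i \<noteq> 0)" for x :: "nat \<Rightarrow> 'a"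
    by (auto simp: vec_eq_iff)
  have "leading_minor a n = 0 \<longleftrightarrow>
      (\<exists>v. v \<in> carrier_vec n \<and> v \<noteq> 0\<^sub>v n \<and> ?A *\<^sub>v v = 0\<^sub>v n)"
    unfolding leading_minor_def by (rule det_0_iff_vec_prod_zero_field) simp
  also have "\<dots> \<longleftrightarrow> (\<exists>x. vec n x \<noteq> 0\<^sub>v n \<and> ?A *\<^sub>v vec n x = 0\<^sub>v n)"
  proof (intro iffI; elim exE conjE)
    fix v assume "v \<in> carrier_vec n" "v \<noteq> 0\<^sub>v n" "?A *\<^sub>v v = 0\<^sub>v n"
    moreover from this have "vec n (\<lambda>i. v $ i) = v" by auto
    ultimately show "\<exists>x. vec n x \<noteq> 0\<^sub>v n \<and> ?A *\<^sub>v vec n x = 0\<^sub>v n" by metis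
  qed (use vec_carrier in blast)
  finally show ?thesis by (simp only: mult nz)
qed

text \<open>
  The witness \<open>u\<close>, the last column of the adjugate matrix, has \<open>bilin a (Suc n) u u\<close> equal to the
  product of two consecutive leading minors, which drives the induction in Sylvester's criterion.
\<close>

lemma ex_leading_minor_column:
  "\<exists>u. u n = leading_minor a n \<and>
     (\<forall>i<Suc n. (\<Sum>l<Suc n. a i l * u l) = (if i = n then leading_minor a (Suc n) else 0))"
proof -
  let ?A = "mat (Suc n) (Suc n) (\<lambda>(i, l). a i l)"
  have A: "?A \<in> carrier_mat (Suc n) (Suc n)" by simp
  let ?u = "\<lambda>l. adj_mat ?A $$ (l, n)"
  have adj: "adj_mat ?A \<in> carrier_mat (Suc n) (Suc n)" by (rule adj_mat(1)[OF A])
  \<comment> \<open>The corner entry of the adjugate is a cofactor of sign (-1)^(n+n) = 1, and the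
    deletion leaves the leading block of order \<open>n\<close>.\<close>
  have "mat_delete ?A n n = mat n n (\<lambda>(i, l). a i l)"
    by (auto simp: mat_delete_def)
  hence un: "?u n = leading_minor a n"
    by (simp add: adj_mat_def cofactor_def leading_minor_def)
  have u: "(\<Sum>l<Suc n. a i l * ?u l) = (if i = n then leading_minor a (Suc n) else 0)"
    if i: "i < Suc n" for i
  proof -
    have "(\<Sum>l<Suc n. a i l * ?u l) = (?A * adj_mat ?A) $$ (i, n)"
      using i adj by (auto simp: scalar_prod_def atLeast0LessThan)
    also have "\<dots> = (leading_minor a (Suc n) \<cdot>\<^sub>m 1\<^sub>m (Suc n)) $$ (i, n)"
      by (simp add: adj_mat(2)[OF A] leading_minor_def)
    also have "\<dots> = (if i = n then leading_minor a (Suc n) else 0)"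
      using i by simp
    finally show ?thesis .
  qed
  show ?thesis by (intro exI[of _ ?u] conjI allI impI un u)
qed

lemma pos_def_nonneg:
  assumes "pos_def a n"
  shows "bilin a n x x \<ge> 0"
proof (cases "\<exists>i<n. x i \<noteq> 0")
  case True
  thus ?thesis using assms by (simp add: pos_def_def less_imp_le)
next
  case False
  thus ?thesis by (simp add: bilin_def)
qed

lemma pos_def_mono:
  assumes "pos_def a (Suc n)"
  shows "pos_def a n"
  unfolding pos_def_def
proof (intro allI impI)
  fix x :: "nat \<Rightarrow> real" assume x: "\<exists>i<n. x i \<noteq> 0"
  let ?y = "x(n := 0)"
  have "\<exists>i<Suc n. ?y i \<noteq> 0"
    using x by (auto intro: less_SucI)
  hence "0 < bilin a (Suc n) ?y ?y"
    using assms by (auto simp: pos_def_def)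
  also have "\<dots> = bilin a n ?y ?y" by (rule bilin_Suc_last_zero) auto
  also have "\<dots> = bilin a n x x" by (simp add: bilin_def)
  finally show "bilin a n x x > 0" .
qed

text \<open>Induction on \<open>n\<close>: definiteness at order \<open>Suc n\<close> amounts to
  definiteness at order \<open>n\<close> together with positivity of the new minor. The column
  \<open>u\<close> supplies the additional direction, orthogonal to all vectors with last entry
  0.\<close>

theorem sylvester_criterion:
  assumes sym: "\<And>i l. a i l = a l i"
  shows "pos_def a n \<longleftrightarrow> (\<forall>j\<in>{1..n}. leading_minor a j > 0)"
proof (induction n)
  case 0
  show ?case by (simp add: pos_def_def)
next
  case (Suc n)
  obtain u where un: "u n = leading_minor a n" and u: "\<And>i. i < Suc n \<Longrightarrow>
      (\<Sum>l<Suc n. a i l * u l) = (if i = n then leading_minor a (Suc n) else 0)"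
    using ex_leading_minor_column[of n a] by auto
  have Bu: "bilin a (Suc n) x u = x n * leading_minor a (Suc n)" for x
  proof -
    have "bilin a (Suc n) x u =
        (\<Sum>i<Suc n. x i * (if i = n then leading_minor a (Suc n) else 0))"
      unfolding bilin_def by (intro sum.cong) (simp_all only: u lessThan_iff)
    also have "\<dots> = x n * leading_minor a (Suc n)" by simp
    finally show ?thesis .
  qed
  \<comment> \<open>For \<open>n = 0\<close> the empty determinant is 1.\<close>
  have minor_pos: "leading_minor a n > 0" if "\<forall>j\<in>{1..n}. leading_minor a j > 0"
    using that by (cases "n = 0") (auto simp: leading_minor_def)
  have "pos_def a (Suc n) \<longleftrightarrow> pos_def a n \<and> leading_minor a (Suc n) > 0"
  proof safe
    assume pd: "pos_def a (Suc n)"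
    show "pos_def a n" using pd by (rule pos_def_mono)
    hence D: "leading_minor a n > 0" using Suc minor_pos by blast
    hence "0 < bilin a (Suc n) u u"
      using pd un unfolding pos_def_def by (metis lessI less_irrefl)
    also have "\<dots> = leading_minor a n * leading_minor a (Suc n)"
      by (simp add: Bu un)
    finally show "leading_minor a (Suc n) > 0"
      using D by (simp add: zero_less_mult_iff)
  next
    assume pd: "pos_def a n" and D': "leading_minor a (Suc n) > 0"
    have D: "leading_minor a n > 0" using pd Suc minor_pos by blast
    show "pos_def a (Suc n)"
      unfolding pos_def_def
    proof (intro allI impI)
      fix x :: "nat \<Rightarrow> real" assume x: "\<exists>i<Suc n. x i \<noteq> 0"
      \<comment> \<open>The multiple of \<open>u\<close> is chosen so that the remainder
        \<open>y\<close> has last entry 0; thus \<open>x\<close> splits into two orthogonal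
        parts.\<close>
      define t where "t = x n / u n"
      define y where "y i = x i - t * u i" for i
      have yn: "y n = 0" using D by (simp add: y_def t_def un)
      have xy: "x = (\<lambda>i. t * u i + y i)" by (auto simp: y_def)
      have "bilin a (Suc n) x x = t\<^sup>2 * bilin a (Suc n) u u
          + t * bilin a (Suc n) u y + t * bilin a (Suc n) y u + bilin a (Suc n) y y"
        by (subst (1 2) xy)
           (simp add: bilin_add_left bilin_add_right bilin_scale_left bilin_scale_right
             power2_eq_square algebra_simps)
      also have "bilin a (Suc n) u y = bilin a (Suc n) y u"
        by (rule bilin_commute[OF sym])
      also have "bilin a (Suc n) y u = 0" by (simp add: Bu yn)
      also have "bilin a (Suc n) y y = bilin a n y y"
        by (rule bilin_Suc_last_zero) (fact yn)+
      finally have B: "bilin a (Suc n) x x =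
          t\<^sup>2 * (leading_minor a n * leading_minor a (Suc n)) + bilin a n y y"
        by (simp add: Bu un)
      show "bilin a (Suc n) x x > 0"
      proof (cases "t = 0")
        case True
        hence "y = x" by (auto simp: y_def)
        moreover from x obtain i where "i < Suc n" "x i \<noteq> 0" by blast
        ultimately have "\<exists>i<n. y i \<noteq> 0" using yn by (metis less_antisym)
        thus ?thesis using pd True by (auto simp: B pos_def_def)
      next
        case False
        have "bilin a n y y \<ge> 0" using pd by (rule pos_def_nonneg)
        moreover have "t\<^sup>2 * (leading_minor a n * leading_minor a (Suc n)) > 0"
          using False D D' by simp
        ultimately show ?thesis by (simp add: B)
      qed
    qed
  qed
  also have "\<dots> \<longleftrightarrow> (\<forall>j\<in>{1..Suc n}. leading_minor a j > 0)"
    by (simp add: Suc atLeastAtMostSuc_conv conj_commute)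
  finally show ?case .
qed

section \<open>Hankel forms of weighted power sums\<close>

text \<open>As \<open>z ^ (i + l)\<close> factors, the sum over \<open>Z\<close> moves outside and
  each vector acts as the coefficients of a polynomial evaluated at the nodes: the Vandermonde
  factorisation of a Hankel matrix.\<close>

lemma bilin_power_sums:
  assumes "\<And>k. s k = (\<Sum>z\<in>Z. w z * z ^ k)"
  shows "bilin (\<lambda>i l. s (i + l)) n x y =
    (\<Sum>z\<in>Z. w z * (\<Sum>i<n. x i * z ^ i) * (\<Sum>l<n. y l * z ^ l))"
proof -
  have "bilin (\<lambda>i l. s (i + l)) n x y =
      (\<Sum>i<n. \<Sum>l<n. \<Sum>z\<in>Z. w z * (x i * z ^ i) * (y l * z ^ l))"
    by (simp add: bilin_def assms sum_distrib_left sum_distrib_right power_add mult_ac)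
  also have "\<dots> = (\<Sum>i<n. \<Sum>z\<in>Z. \<Sum>l<n. w z * (x i * z ^ i) * (y l * z ^ l))"
    by (intro sum.cong refl sum.swap)
  also have "\<dots> = (\<Sum>z\<in>Z. \<Sum>i<n. \<Sum>l<n. w z * (x i * z ^ i) * (y l * z ^ l))"
    by (rule sum.swap)
  also have "\<dots> = (\<Sum>z\<in>Z. w z * (\<Sum>i<n. x i * z ^ i) * (\<Sum>l<n. y l * z ^ l))"
    by (simp add: sum_distrib_left sum_distrib_right mult_ac)
  finally show ?thesis .
qed

lemma poly_eq_sum_lessThan:
  fixes p :: "'a::comm_semiring_1 poly"
  assumes "degree p < n"
  shows "poly p z = (\<Sum>i<n. coeff p i * z ^ i)"
  unfolding poly_altdef
  by (rule sum.mono_neutral_left) (use assms in \<open>auto simp: coeff_eq_0\<close>)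

text \<open>A nonzero polynomial of degree less than \<open>n\<close> has fewer than
  \<open>n\<close> roots.\<close>

lemma ex_sum_powers_nonzero:
  fixes Z :: "'a::idom set"
  assumes Z: "n \<le> card Z" and x: "\<exists>i<n. x i \<noteq> 0"
  shows "\<exists>z\<in>Z. (\<Sum>i<n. x i * z ^ i) \<noteq> 0"
proof (rule ccontr)
  assume contra: "\<not> ?thesis"
  define p where "p = (\<Sum>i<n. monom (x i) i)"
  have "coeff p i = x i" if "i < n" for i
    using that by (simp add: p_def coeff_sum)
  hence p0: "p \<noteq> 0" using x by auto
  have "degree p < n"
    unfolding p_def using x
    by (intro degree_sum_less) (auto intro: le_less_trans[OF degree_monom_le])
  have "poly p z = (\<Sum>i<n. x i * z ^ i)" for z
    by (simp add: p_def poly_sum poly_monom)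
  hence "Z \<subseteq> {z. poly p z = 0}" using contra by auto
  hence "card Z \<le> card {z. poly p z = 0}"
    by (intro card_mono poly_roots_finite p0)
  also have "\<dots> \<le> degree p" by (rule card_poly_roots_bound[OF p0])
  finally show False using Z \<open>degree p < n\<close> by simp
qed

lemma degree_prod_linear:
  fixes Z :: "'a::idom set"
  shows "degree (\<Prod>z\<in>Z. [:- z, 1:]) = card Z"
  by (subst degree_prod_eq_sum_degree) auto

text \<open>At order \<open>card Z\<close> a kernel vector is tested against a polynomial that
  isolates one node; at higher orders the polynomial vanishing at all nodes fits into the vector
  length and gives a kernel vector.\<close>

lemma leading_minor_power_sums:
  fixes Z :: "'a::field set"
  assumes fin: "finite Z" and w: "\<And>z. z \<in> Z \<Longrightarrow> w z \<noteq> 0"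
    and s: "\<And>k. s k = (\<Sum>z\<in>Z. w z * z ^ k)"
  shows "leading_minor (\<lambda>i l. s (i + l)) (card Z) \<noteq> 0"
    and "card Z < n \<Longrightarrow> leading_minor (\<lambda>i l. s (i + l)) n = 0"
proof -
  show "leading_minor (\<lambda>i l. s (i + l)) (card Z) \<noteq> 0"
  proof
    let ?n = "card Z"
    assume "leading_minor (\<lambda>i l. s (i + l)) ?n = 0"
    then obtain x where x: "\<exists>i<?n. x i \<noteq> 0"
      and ker: "\<And>i. i < ?n \<Longrightarrow> (\<Sum>l<?n. s (i + l) * x l) = 0"
      by (auto simp: leading_minor_eq_0_iff)
    obtain z where z: "z \<in> Z" "(\<Sum>i<?n. x i * z ^ i) \<noteq> 0"
      using ex_sum_powers_nonzero[OF order.refl x] by blast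
    \<comment> \<open>The numerator of the Lagrange basis polynomial at \<open>z\<close>, a node
      where the polynomial of the kernel vector is nonzero.\<close>
    define g where "g = (\<Prod>v\<in>Z-{z}. [:- v, 1:])"
    have "card Z > 0" using z fin by (auto simp: card_gt_0_iff)
    hence "degree g < ?n"
      using z fin by (simp add: g_def degree_prod_linear)
    hence g: "poly g v = (\<Sum>i<?n. coeff g i * v ^ i)" for v
      by (rule poly_eq_sum_lessThan)
    have g0: "poly g v = 0 \<longleftrightarrow> v \<in> Z - {z}" for v
      using fin by (auto simp: g_def poly_prod)
    have "0 = bilin (\<lambda>i l. s (i + l)) ?n (coeff g) x"
      by (simp add: bilin_def ker)
    also have "\<dots> = (\<Sum>v\<in>Z. w v * poly g v * (\<Sum>l<?n. x l * v ^ l))"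
      unfolding g by (rule bilin_power_sums[OF s])
    also have "\<dots> = (\<Sum>v\<in>{z}. w v * poly g v * (\<Sum>l<?n. x l * v ^ l))"
      using fin z by (intro sum.mono_neutral_right) (auto simp: g0)
    finally show False using z w g0[of z] by simp
  qed
  assume n: "card Z < n"
  define q where "q = (\<Prod>v\<in>Z. [:- v, 1:])"
  have "degree q < n" using n by (simp add: q_def degree_prod_linear)
  hence q: "poly q v = (\<Sum>i<n. coeff q i * v ^ i)" for v
    by (rule poly_eq_sum_lessThan)
  have "q \<noteq> 0" using fin by (simp add: q_def)
  hence "coeff q (degree q) \<noteq> 0" by simp
  moreover have "(\<Sum>l<n. s (i + l) * coeff q l) = 0" if "i < n" for i
  proof -
    \<comment> \<open>Row \<open>i\<close> is extracted by pairing with the \<open>i\<close>-th unit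
      vector.\<close>
    have "(\<Sum>l<n. s (i + l) * coeff q l) =
        bilin (\<lambda>i l. s (i + l)) n (\<lambda>k. if k = i then 1 else 0) (coeff q)"
      using that by (simp add: bilin_def if_distrib[of "\<lambda>x. x * _"] cong: if_cong)
    also have "\<dots> = (\<Sum>z\<in>Z. w z * (\<Sum>l<n. (if l = i then 1 else 0) * z ^ l) * poly q z)"
      unfolding q by (rule bilin_power_sums[OF s])
    also have "\<dots> = 0"
      using fin by (intro sum.neutral) (auto simp: q_def poly_prod)
    finally show ?thesis .
  qed
  ultimately show "leading_minor (\<lambda>i l. s (i + l)) n = 0"
    unfolding leading_minor_eq_0_iff using \<open>degree q < n\<close> by blast
qed

text \<open>With real nodes the form is a positively weighted sum of squares of polynomial values,
  which cannot all vanish while there are at most \<open>card Z\<close> coefficients.\<close>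

lemma pos_def_power_sums:
  fixes Z :: "real set"
  assumes fin: "finite Z" and w: "\<And>z. z \<in> Z \<Longrightarrow> w z > 0"
    and s: "\<And>k. s k = (\<Sum>z\<in>Z. w z * z ^ k)" and n: "n \<le> card Z"
  shows "pos_def (\<lambda>i l. s (i + l)) n"
  unfolding pos_def_def
proof (intro allI impI)
  fix x :: "nat \<Rightarrow> real" assume "\<exists>i<n. x i \<noteq> 0"
  then obtain z where z: "z \<in> Z" "(\<Sum>i<n. x i * z ^ i) \<noteq> 0"
    using ex_sum_powers_nonzero[OF n] by blast
  have "0 < (\<Sum>z\<in>Z. w z * (\<Sum>i<n. x i * z ^ i)\<^sup>2)"
    by (rule sum_pos2[OF fin z(1)]) (use w z in \<open>auto simp: less_imp_le\<close>)
  also have "\<dots> = bilin (\<lambda>i l. s (i + l)) n x x"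
    by (simp add: bilin_power_sums[OF s] power2_eq_square mult_ac)
  finally show "bilin (\<lambda>i l. s (i + l)) n x x > 0" .
qed

text \<open>The real part of the Hermitian form is the sum of the real form at the real parts and at
  the imaginary parts; neither term is negative and at least one is positive.\<close>

lemma pos_def_cnj:
  assumes pd: "pos_def a n" and x: "\<exists>i<n. x i \<noteq> 0"
  shows "bilin (\<lambda>i l. complex_of_real (a i l)) n x (\<lambda>l. cnj (x l)) \<noteq> 0"
proof -
  let ?R = "\<lambda>i. Re (x i)" and ?I = "\<lambda>i. Im (x i)"
  have "Re (bilin (\<lambda>i l. complex_of_real (a i l)) n x (\<lambda>l. cnj (x l))) =
      bilin a n ?R ?R + bilin a n ?I ?I"
    by (simp add: bilin_def sum_distrib_left sum.distrib algebra_simps sum_negf)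
  moreover have "(\<exists>i<n. ?R i \<noteq> 0) \<or> (\<exists>i<n. ?I i \<noteq> 0)"
    using x by (auto simp: complex_eq_iff)
  hence "bilin a n ?R ?R > 0 \<or> bilin a n ?I ?I > 0"
    using pd by (auto simp: pos_def_def)
  ultimately have "Re (bilin (\<lambda>i l. complex_of_real (a i l)) n x (\<lambda>l. cnj (x l))) > 0"
    using pos_def_nonneg[OF pd, of ?R] pos_def_nonneg[OF pd, of ?I] by linarith
  thus ?thesis by auto
qed

text \<open>A nonreal node \<open>z\<close> would give a nonzero \<open>g\<close>, vanishing at all
  other nodes, at which the Hermitian form is 0.\<close>

lemma power_sums_nodes_real:
  assumes fin: "finite Z" and s: "\<And>k. complex_of_real (s k) = (\<Sum>z\<in>Z. w z * z ^ k)"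
    and cnj: "cnj ` Z \<subseteq> Z" and pd: "pos_def (\<lambda>i l. s (i + l)) (card Z)"
  shows "Z \<subseteq> \<real>"
proof
  fix z assume z: "z \<in> Z"
  show "z \<in> \<real>"
  proof (rule ccontr)
    assume nonreal: "z \<notin> \<real>"
    let ?n = "card Z"
    define g where "g = (\<Prod>v\<in>Z-{z}. [:- v, 1:])"
    have "card Z > 0" using z fin by (auto simp: card_gt_0_iff)
    hence deg: "degree g < ?n"
      using z fin by (simp add: g_def degree_prod_linear)
    hence g: "poly g v = (\<Sum>i<?n. coeff g i * v ^ i)" for v
      by (rule poly_eq_sum_lessThan)
    \<comment> \<open>This expresses the second factor of the Hermitian form through
      \<open>g\<close>, whose zeros are known.\<close>
    have g': "cnj (poly g (cnj v)) = (\<Sum>i<?n. cnj (coeff g i) * v ^ i)" for v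
      by (simp add: g)
    have g0: "poly g v = 0" if "v \<in> Z - {z}" for v
      using fin that by (auto simp: g_def poly_prod)
    have "g \<noteq> 0" using fin by (simp add: g_def)
    hence "coeff g (degree g) \<noteq> 0" by simp
    with deg have "\<exists>i<?n. coeff g i \<noteq> 0" by blast
    hence "bilin (\<lambda>i l. complex_of_real (s (i + l))) ?n (coeff g) (\<lambda>l. cnj (coeff g l)) \<noteq> 0"
      by (rule pos_def_cnj[OF pd])
    also have "bilin (\<lambda>i l. complex_of_real (s (i + l))) ?n (coeff g) (\<lambda>l. cnj (coeff g l)) =
        (\<Sum>v\<in>Z. w v * poly g v * cnj (poly g (cnj v)))"
      using bilin_power_sums[OF s, of ?n "coeff g" "\<lambda>l. cnj (coeff g l)"]
      by (simp only: g[symmetric] g'[symmetric])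
    also have "\<dots> = 0"
    proof (intro sum.neutral ballI)
      fix v assume v: "v \<in> Z"
      \<comment> \<open>For \<open>v = z\<close> the second factor vanishes, as \<open>cnj z\<close>
        is another node; for every other \<open>v\<close> the first one does.\<close>
      have "cnj z \<in> Z - {z}"
        using z cnj nonreal by (auto simp: Reals_cnj_iff)
      hence "poly g v = 0 \<or> poly g (cnj v) = 0"
        using v g0 by (cases "v = z") auto
      thus "w v * poly g v * cnj (poly g (cnj v)) = 0" by auto
    qed
    finally show False by simp
  qed
qed

section \<open>Expansions at infinity and the logarithmic derivative\<close>

lemma poly_at_infinity_0 [simp]: "poly_at_infinity 0 = 0"
  by (simp add: poly_at_infinity_def)

lemma poly_at_infinity_pCons:
  "poly_at_infinity (pCons c p) = fls_const c + fls_X_inv * poly_at_infinity p"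
  by (cases "c = 0 \<and> p = 0") (auto simp: poly_at_infinity_def map_poly_pCons)

lemma poly_at_infinity_add: "poly_at_infinity (p + q) = poly_at_infinity p + poly_at_infinity q"
  by (induction p q rule: poly_induct2)
     (simp_all add: poly_at_infinity_pCons fls_plus_const[symmetric] algebra_simps)

lemma poly_at_infinity_smult: "poly_at_infinity (Polynomial.smult c p) = fls_const c * poly_at_infinity p"
  by (induction p) (simp_all add: poly_at_infinity_pCons algebra_simps flip: fls_const_mult_const)

lemma poly_at_infinity_mult: "poly_at_infinity (p * q) = poly_at_infinity p * poly_at_infinity q"
  by (induction p)
     (simp_all add: poly_at_infinity_pCons poly_at_infinity_add poly_at_infinity_smult algebra_simps)

text \<open>Multiplication by \<open>fls_X_inv ^ i\<close> shifts a series by \<open>i\<close>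
  places. Identities between series thus become comparisons of finite sums, and \<open>F = 1\<close>
  reads off \<open>poly_at_infinity p\<close> itself.\<close>

lemma fls_nth_times_poly_at_infinity:
  fixes p :: "'a::field poly"
  shows "fls_nth (F * poly_at_infinity p) k = (\<Sum>i\<le>degree p. coeff p i * fls_nth F (k + int i))"
proof -
  have "poly_at_infinity p = (\<Sum>i\<le>degree p. fls_const (coeff p i) * fls_X_inv ^ i)"
    by (simp add: poly_at_infinity_def poly_altdef coeff_map_poly degree_map_poly)
  hence "F * poly_at_infinity p = (\<Sum>i\<le>degree p. fls_const (coeff p i) * (F * fls_X_inv ^ i))"
    by (simp add: sum_distrib_left mult_ac)
  thus ?thesis
    by (simp add: fls_nth_sum fls_X_inv_power_times_conv_shift)
qed

lemma poly_at_infinity_eq_0_iff [simp]: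
  fixes p :: "'a::field poly"
  shows "poly_at_infinity p = 0 \<longleftrightarrow> p = 0"
proof
  assume 0: "poly_at_infinity p = 0"
  have "fls_nth (1 * poly_at_infinity p) (- int (degree p)) =
      (\<Sum>i\<le>degree p. if i = degree p then coeff p i else 0)"
    unfolding fls_nth_times_poly_at_infinity by (intro sum.cong) auto
  thus "p = 0" using 0 by simp
qed simp

lemma log_deriv_at_infinity_mult:
  fixes p q :: "'a::field poly"
  assumes "p \<noteq> 0" "q \<noteq> 0"
  shows "log_deriv_at_infinity (p * q) = log_deriv_at_infinity p + log_deriv_at_infinity q"
  using assms
  by (simp add: log_deriv_at_infinity_def pderiv_mult poly_at_infinity_mult poly_at_infinity_add
      add_divide_distrib)

lemma log_deriv_at_infinity_const [simp]: "log_deriv_at_infinity [:c:] = 0"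
  by (simp add: log_deriv_at_infinity_def pderiv_pCons)

lemma log_deriv_at_infinity_smult:
  fixes p :: "'a::field poly"
  assumes "c \<noteq> 0" "p \<noteq> 0"
  shows "log_deriv_at_infinity (Polynomial.smult c p) = log_deriv_at_infinity p"
  using log_deriv_at_infinity_mult[of "[:c:]" p] assms by simp

lemma log_deriv_at_infinity_power:
  fixes p :: "'a::field poly"
  assumes "p \<noteq> 0"
  shows "log_deriv_at_infinity (p ^ n) = of_nat n * log_deriv_at_infinity p"
proof (induction n)
  case 0
  show ?case by (simp add: one_pCons)
next
  case (Suc n)
  thus ?case using assms by (simp add: log_deriv_at_infinity_mult algebra_simps)
qed

lemma log_deriv_at_infinity_prod:
  fixes f :: "'b \<Rightarrow> 'a::field poly"
  assumes "finite A" "\<And>x. x \<in> A \<Longrightarrow> f x \<noteq> 0"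
  shows "log_deriv_at_infinity (prod f A) = (\<Sum>x\<in>A. log_deriv_at_infinity (f x))"
  using assms
proof (induction A rule: finite_induct)
  case empty
  show ?case by (simp add: one_pCons)
next
  case (insert x A)
  thus ?case by (simp add: log_deriv_at_infinity_mult)
qed

text \<open>The geometric series 1/(z - c) = 1/z + c/z^2 + ..., checked by multiplying back; the
  factor \<open>fps_X\<close> provides the initial 1/z.\<close>

lemma log_deriv_at_infinity_linear:
  fixes c :: "'a::field"
  shows "log_deriv_at_infinity [:- c, 1:] = fps_to_fls (fps_X * Abs_fps (\<lambda>k. c ^ k))"
    (is "_ = ?G")
proof -
  have nth: "fls_nth ?G k = (if k \<ge> 1 then c ^ nat (k - 1) else 0)" for k
    by (auto simp: nat_diff_distrib)
  have "?G * poly_at_infinity [:- c, 1:] = 1"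
  proof (rule fls_eqI)
    fix k :: int
    show "fls_nth (?G * poly_at_infinity [:- c, 1:]) k = fls_nth 1 k"
      unfolding fls_nth_times_poly_at_infinity nth
      by (cases "k \<ge> 1") (auto simp: nat_diff_distrib nat_add_distrib simp flip: power_Suc)
  qed
  moreover have "poly_at_infinity (pderiv [:- c, 1:]) = 1"
    by (simp add: pderiv_pCons poly_at_infinity_pCons)
  ultimately show ?thesis
    unfolding log_deriv_at_infinity_def
    by (metis nonzero_divide_eq_eq mult_zero_right zero_neq_one)
qed

text \<open>Over the complex numbers the polynomial splits into linear factors, whose multiplicities
  become the weights of the geometric series.\<close>

lemma fls_nth_log_deriv_at_infinity:
  fixes p :: "complex poly"
  assumes "p \<noteq> 0"
  shows "fls_nth (log_deriv_at_infinity p) (int k + 1) =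
    (\<Sum>z | poly p z = 0. of_nat (Polynomial.order z p) * z ^ k)"
proof -
  let ?Z = "{z. poly p z = 0}"
  have fin: "finite ?Z" using assms by (rule poly_roots_finite)
  have "log_deriv_at_infinity p =
      log_deriv_at_infinity (Polynomial.smult (lead_coeff p) (\<Prod>z\<in>?Z. [:- z, 1:] ^ Polynomial.order z p))"
    by (simp only: complex_poly_decompose)
  also have "\<dots> = (\<Sum>z\<in>?Z. of_nat (Polynomial.order z p) * log_deriv_at_infinity [:- z, 1:])"
    using assms fin
    by (simp add: log_deriv_at_infinity_smult log_deriv_at_infinity_prod log_deriv_at_infinity_power)
  finally show ?thesis
    by (simp add: fls_nth_sum log_deriv_at_infinity_linear fls_of_nat nat_add_distrib)
qed

text \<open>The determinants are real but the splitting is complex. A quotient is determined by its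
  product with the denominator, and that relation carries over coefficientwise.\<close>

lemma fls_nth_log_deriv_at_infinity_of_real:
  fixes p :: "real poly"
  assumes "p \<noteq> 0"
  shows "fls_nth (log_deriv_at_infinity (map_poly of_real p :: complex poly)) k =
    of_real (fls_nth (log_deriv_at_infinity p) k)"
proof -
  let ?F = "log_deriv_at_infinity p" and ?q = "map_poly of_real p :: complex poly"
  \<comment> \<open>The coefficientwise image of the real quotient; the lower bound on indices that
    \<open>Abs_fls\<close> requires is the subdegree of \<open>?F\<close>.\<close>
  define G where "G = Abs_fls (\<lambda>k. complex_of_real (fls_nth ?F k))"
  have G: "fls_nth G k = complex_of_real (fls_nth ?F k)" for k
    unfolding G_def
    by (rule nth_Abs_fls_lower_bound[of "fls_subdegree ?F"]) simp
  have q: "degree ?q = degree p" "pderiv ?q = map_poly of_real (pderiv p)" "?q \<noteq> 0"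
    using assms by (auto simp: degree_map_poly map_poly_eq_0_iff poly_eq_iff coeff_pderiv coeff_map_poly
        simp del: of_nat_Suc)
  have nth: "fls_nth (poly_at_infinity (map_poly of_real r :: complex poly)) k =
      of_real (fls_nth (poly_at_infinity r) k)" for k and r :: "real poly"
    using fls_nth_times_poly_at_infinity[of 1 r k]
      fls_nth_times_poly_at_infinity[of 1 "map_poly of_real r :: complex poly" k]
    by (simp add: degree_map_poly coeff_map_poly if_distrib cong: if_cong)
  have "?F * poly_at_infinity p = poly_at_infinity (pderiv p)"
    using assms by (simp add: log_deriv_at_infinity_def)
  hence "fls_nth (G * poly_at_infinity ?q) k = fls_nth (poly_at_infinity (pderiv ?q)) k" for k
    using fls_nth_times_poly_at_infinity[of ?F p k]
    by (simp add: fls_nth_times_poly_at_infinity q nth G coeff_map_poly)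
  hence "G * poly_at_infinity ?q = poly_at_infinity (pderiv ?q)"
    by (intro fls_eqI) 
  hence "G = log_deriv_at_infinity ?q"
    using q(3) by (simp add: log_deriv_at_infinity_def field_simps)
  thus ?thesis using G[of k] by simp
qed

section \<open>Counting real zeros by Hankel determinants\<close>

theorem theorem4p10:
  fixes p :: "real poly" and n m :: nat
  assumes "degree p = n" and "lead_coeff p > 0" and "n \<ge> 1"
    and "1 \<le> m" and "m \<le> n"
  shows "(card {z :: complex. poly (map_poly of_real p) z = 0} = m \<and>
          (\<forall>z :: complex. poly (map_poly of_real p) z = 0 \<longrightarrow> z \<in> \<real>))
     \<longleftrightarrow>
         ((\<forall>j\<in>{1..m}. hankel_det j (log_deriv_at_infinity p) > 0) \<and>
          (\<forall>j>m. hankel_det j (log_deriv_at_infinity p) = 0))"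
proof -
  let ?L = "log_deriv_at_infinity p" and ?q = "map_poly of_real p :: complex poly"
  define Z where "Z = {z. poly ?q z = 0}"
  define s where "s k = fls_nth ?L (int k + 1)" for k
  define w where "w z = real (Polynomial.order z ?q)" for z
  have p: "p \<noteq> 0" using assms(2) by auto
  hence q: "?q \<noteq> 0" by (simp add: map_poly_eq_0_iff)
  have fin: "finite Z" unfolding Z_def by (rule poly_roots_finite[OF q])
  have w: "w z > 0" if "z \<in> Z" for z
    using that q by (simp add: w_def Z_def order_root)
  have s: "complex_of_real (s k) = (\<Sum>z\<in>Z. complex_of_real (w z) * z ^ k)" for k
    using fls_nth_log_deriv_at_infinity[OF q, of k]
    by (simp add: s_def w_def Z_def fls_nth_log_deriv_at_infinity_of_real[OF p])
  have minor: "hankel_det j ?L = leading_minor (\<lambda>i l. s (i + l)) j" for j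
    by (simp add: hankel_det_def leading_minor_def s_def)
  \<comment> \<open>The determinant commutes with \<open>of_real\<close>, so vanishing and
    nonvanishing proved with complex nodes hold for the real minors.\<close>
  have minor_of_real: "complex_of_real (leading_minor (\<lambda>i l. s (i + l)) j) =
      leading_minor (\<lambda>i l. complex_of_real (s (i + l))) j" for j
    unfolding leading_minor_def of_real_hom.hom_det[symmetric]
    by (rule arg_cong[of _ _ det]) auto
  have w0: "complex_of_real (w z) \<noteq> 0" if "z \<in> Z" for z
    using w[OF that] by simp
  note minors = leading_minor_power_sums[OF fin w0 s, folded minor_of_real]
  have card: "leading_minor (\<lambda>i l. s (i + l)) (card Z) \<noteq> 0"
    using minors(1) by simp
  have above: "leading_minor (\<lambda>i l. s (i + l)) j = 0" if "card Z < j" for j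
    using minors(2)[OF _ that] by simp
  have sylv: "pos_def (\<lambda>i l. s (i + l)) m \<longleftrightarrow> (\<forall>j\<in>{1..m}. hankel_det j ?L > 0)"
    unfolding minor by (rule sylvester_criterion) (simp add: add.commute)
  have cnj: "cnj ` Z \<subseteq> Z"
    by (auto simp: Z_def real_poly_cnj_root_iff coeff_map_poly)
  have "card Z = m \<and> Z \<subseteq> \<real> \<longleftrightarrow>
      (\<forall>j\<in>{1..m}. hankel_det j ?L > 0) \<and> (\<forall>j>m. hankel_det j ?L = 0)"
  proof (intro iffI; elim conjE)
    assume Z: "card Z = m" "Z \<subseteq> \<real>"
    \<comment> \<open>\<open>Re\<close> maps \<open>Z\<close> injectively onto real nodes with the
      same weights and power sums, to which \<open>pos_def_power_sums\<close> applies.\<close>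
    have Re: "of_real (Re z) = z" if "z \<in> Z" for z
      using that Z(2) by auto
    have inj: "inj_on Re Z" by (rule inj_on_inverseI[of _ of_real]) (rule Re)
    have "complex_of_real (s k) = of_real (\<Sum>z\<in>Z. w z * Re z ^ k)" for k
      unfolding s by (simp add: Re)
    hence "s k = (\<Sum>z\<in>Z. w z * Re z ^ k)" for k
      by (simp only: of_real_eq_iff)
    hence "s k = (\<Sum>x\<in>Re ` Z. w (of_real x) * x ^ k)" for k
      by (simp add: sum.reindex[OF inj] Re)
    hence "pos_def (\<lambda>i l. s (i + l)) m"
      using fin w Z(1) inj
      by (intro pos_def_power_sums[of "Re ` Z" "\<lambda>x. w (of_real x)"]) (auto simp: card_image Re)
    moreover have "\<forall>j>m. hankel_det j ?L = 0" using Z(1) by (simp add: minor above)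
    ultimately show "(\<forall>j\<in>{1..m}. hankel_det j ?L > 0) \<and> (\<forall>j>m. hankel_det j ?L = 0)"
      using sylv by blast
  next
    assume pos: "\<forall>j\<in>{1..m}. hankel_det j ?L > 0" and zero: "\<forall>j>m. hankel_det j ?L = 0"
    \<comment> \<open>The minor of order \<open>card Z\<close> is nonzero and all later ones vanish,
      so the sign pattern pins down \<open>card Z\<close>; \<open>1 \<le> m\<close> makes order
      \<open>m\<close> one of the positive ones.\<close>
    have "\<not> m < card Z" using zero card by (auto simp: minor)
    moreover have "\<not> card Z < m" using pos[rule_format, of m] above[of m] assms(4) by (auto simp: minor)
    ultimately have m: "card Z = m" by simp
    moreover have "Z \<subseteq> \<real>"
      using power_sums_nodes_real[OF fin s cnj] sylv pos m by blast
    ultimately show "card Z = m \<and> Z \<subseteq> \<real>" by blast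
  qed
  thus ?thesis by (auto simp: Z_def)
qed

end
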